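(* Suppose that: (A1) $\mathrm{D}G_0$ is $L_1$-Lipschitz on $\mathcal{X}$, and there is $m>0$ such that $\mathrm{Sym}(\mathrm{D}G_0(x)) \succeq \frac{m}{2} I$ for all $x\in\mathcal{X}$; (A2) $\Phi:\mathcal{X}\to\mathbb{R}$ is $\mu_\Phi$-strongly convex on $\mathcal{X}$ with $L_2$-Lipschitz gradient, and its unique minimizer $x^\dagger=\arg\min_{x\in\mathcal{X}}\Phi(x)$ lies in $\operatorname{int}\mathcal{X}$. Let $c^*=\min_{x\in\partial\mathcal{X}}\Phi(x)-\Phi(x^\dagger)>0$ and $p^\dagger=-G_0(x^\dagger)\in\mathcal{P}$. For $c\ge 0$ let $$\mathcal{P}_c=\{p\in\mathcal{P}:\ \Phi(x^*(p))-\Phi(x^\dagger)\le c\}.$$ Consider the dynamics $$\dot p(t)=\nabla\Phi(x)\big|_{x=x^*(p(t))},\qquad p(0)\in\mathcal{P}.$$ Then for any $0\le c<c^*$ the set $\mathcal{P}_c$ is compact and forward invariant under these dynamics. Moreover, $\mathcal{P}_c$ contains a unique asymptotically stable equilibrium, at $p^\dagger$. In particular, for any $p(0)\in\mathcal{P}_c$, the trajectory of the dynamics satisfies $\lim_{t\to\infty}p(t)=p^\dagger$.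
   Context: Setting. There are $n$ agents $\mathcal N=\{1,\dots,n\}$. Agent $i$ has a compact convex strategy set $\mathcal{X}_i\subset\mathbb{R}$, and $\mathcal{X}=\prod_{i}\mathcal{X}_i\subset\mathbb{R}^n$. Each agent has a nominal cost $\ell_i:\mathcal{X}\to\mathbb{R}$ of class $C^2$. Given an incentive $p=(p_i)_i\in\mathbb{R}^n$, agent $i$'s total cost is $c_i^\gamma(x)=\ell_i(x)+p_ix_i$. The nominal pseudo-gradient is $G_0(x)=\big(\tfrac{\partial \ell_1}{\partial x_1}(x),\dots,\tfrac{\partial \ell_n}{\partial x_n}(x)\big)^\top$ and the incentivized pseudo-gradient is $G_\gamma(x)=G_0(x)+p$. $\mathrm{D}F$ denotes the Jacobian of $F$, $\mathrm{Sym}(A)=\frac12(A+A^\top)$, and $I$ is the identity matrix. For $p\in\mathbb{R}^n$, an incentivized Nash equilibrium is a point $x^*(p)\in\mathcal{X}$ with $G_\gamma(x^*(p))^\top(x-x^*(p))\ge 0$ for all $x\in\mathcal{X}$; under (A1) it exists and is unique for every $p$. The map $p\mapsto x^*(p)$ is called the response map. The set $\mathcal{P}$ is $\mathcal{P}=-G_0(\operatorname{int}\mathcal{X})\subset\mathbb{R}^n$. A function $f$ is $\mu$-strongly convex on $\mathcal{X}$ if $f(y)\ge f(x)+\langle\nabla f(x),y-x\rangle+\frac{\mu}{2}\|y-x\|^2$ for all $x,y\in\mathcal{X}$. $\partial\mathcal{X}$ denotes the topological boundary of $\mathcal{X}$. *)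

theory Defs
  imports "HOL-Analysis.Analysis"
begin

text \<open>
  The cost functions are only meaningful on a box \<open>X\<close>, so all derivatives are taken within \<open>X\<close>
  (one-sided at faces of the box). They are uniquely determined when \<open>X\<close> is a convex set with
  nonempty interior.
\<close>

definition partial_on :: "(real^'n) set \<Rightarrow> (real^'n \<Rightarrow> real) \<Rightarrow> 'n \<Rightarrow> real^'n \<Rightarrow> real" where
  "partial_on X f i x =
     vector_derivative (\<lambda>s. f (x + s *\<^sub>R axis i 1)) (at 0 within {s. x + s *\<^sub>R axis i 1 \<in> X})"

definition gradient_on :: "(real^'n) set \<Rightarrow> (real^'n \<Rightarrow> real) \<Rightarrow> real^'n \<Rightarrow> real^'n" where
  "gradient_on X f x = (\<chi> i. partial_on X f i x)"

definition C2_on :: "(real^'n) set \<Rightarrow> (real^'n \<Rightarrow> real) \<Rightarrow> bool" where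
  "C2_on X f \<longleftrightarrow> (\<exists>(g :: real^'n \<Rightarrow> real^'n) (H :: real^'n \<Rightarrow> real^'n^'n).
     (\<forall>x\<in>X. (f has_derivative (\<lambda>v. g x \<bullet> v)) (at x within X)) \<and>
     (\<forall>x\<in>X. (g has_derivative (\<lambda>v. H x *v v)) (at x within X)) \<and>
     continuous_on X H)"

definition strongly_convex_on :: "real \<Rightarrow> (real^'n) set \<Rightarrow> (real^'n \<Rightarrow> real) \<Rightarrow> bool" where
  "strongly_convex_on \<mu> X f \<longleftrightarrow>
     (\<forall>x\<in>X. \<forall>y\<in>X. f y \<ge> f x + gradient_on X f x \<bullet> (y - x) + \<mu> / 2 * (norm (y - x))\<^sup>2)"

definition Sym :: "real^'n^'n \<Rightarrow> real^'n^'n" where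
  "Sym A = (1 / 2) *\<^sub>R (A + transpose A)"

text \<open>Loewner order; only used for symmetric matrices.\<close>

definition loewner_le :: "real^'n^'n \<Rightarrow> real^'n^'n \<Rightarrow> bool" where
  "loewner_le A B \<longleftrightarrow> (\<forall>v. 0 \<le> v \<bullet> ((B - A) *v v))"

text \<open>
  Lipschitz continuity of a matrix-valued map with respect to the operator norm. The norm of the
  type \<open>real^'n^'n\<close> itself is the Frobenius norm.
\<close>

definition matrix_lipschitz_on :: "real \<Rightarrow> (real^'n) set \<Rightarrow> (real^'n \<Rightarrow> real^'n^'n) \<Rightarrow> bool" where
  "matrix_lipschitz_on L X A \<longleftrightarrow> (\<forall>x\<in>X. \<forall>y\<in>X. onorm ((*v) (A x - A y)) \<le> L * dist x y)"

definition strategy_space :: "('n \<Rightarrow> real set) \<Rightarrow> (real^'n) set" where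
  "strategy_space Xs = {x. \<forall>i. x $ i \<in> Xs i}"

definition pseudo_gradient :: "(real^'n) set \<Rightarrow> ('n \<Rightarrow> real^'n \<Rightarrow> real) \<Rightarrow> real^'n \<Rightarrow> real^'n" where
  "pseudo_gradient X cost x = (\<chi> i. partial_on X (cost i) i x)"

definition incentivized_pseudo_gradient ::
    "(real^'n \<Rightarrow> real^'n) \<Rightarrow> real^'n \<Rightarrow> real^'n \<Rightarrow> real^'n" where
  "incentivized_pseudo_gradient G0 p x = G0 x + p"

definition incentivized_nash ::
    "(real^'n) set \<Rightarrow> (real^'n \<Rightarrow> real^'n) \<Rightarrow> real^'n \<Rightarrow> real^'n \<Rightarrow> bool" where
  "incentivized_nash X G0 p x \<longleftrightarrow>
     x \<in> X \<and> (\<forall>y\<in>X. 0 \<le> incentivized_pseudo_gradient G0 p x \<bullet> (y - x))"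

text \<open>
  Well defined for every \<open>p\<close> when \<open>X\<close> is nonempty, compact and convex and \<open>G0\<close> is continuous and
  strongly monotone on \<open>X\<close>.
\<close>

definition response :: "(real^'n) set \<Rightarrow> (real^'n \<Rightarrow> real^'n) \<Rightarrow> real^'n \<Rightarrow> real^'n" where
  "response X G0 p = (THE x. incentivized_nash X G0 p x)"

definition incentives :: "(real^'n) set \<Rightarrow> (real^'n \<Rightarrow> real^'n) \<Rightarrow> (real^'n) set" where
  "incentives X G0 = (\<lambda>x. - G0 x) ` interior X"

definition incentive_sublevel ::
    "(real^'n) set \<Rightarrow> (real^'n \<Rightarrow> real^'n) \<Rightarrow> (real^'n \<Rightarrow> real) \<Rightarrow> real^'n \<Rightarrow> real \<Rightarrow> (real^'n) set" where
  "incentive_sublevel X G0 \<Phi> xd c = {p \<in> incentives X G0. \<Phi> (response X G0 p) - \<Phi> xd \<le> c}"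

definition incentive_field ::
    "(real^'n) set \<Rightarrow> (real^'n \<Rightarrow> real^'n) \<Rightarrow> (real^'n \<Rightarrow> real) \<Rightarrow> real^'n \<Rightarrow> real^'n" where
  "incentive_field X G0 \<Phi> p = gradient_on X \<Phi> (response X G0 p)"

definition trajectory_on :: "real set \<Rightarrow> ('a::real_normed_vector \<Rightarrow> 'a) \<Rightarrow> (real \<Rightarrow> 'a) \<Rightarrow> bool" where
  "trajectory_on J f p \<longleftrightarrow> (\<forall>t\<in>J. (p has_vector_derivative f (p t)) (at t within J))"

text \<open>
  Invariance and stability quantify over trajectories on arbitrary intervals \<open>[0,T]\<close>, so that
  trajectories which are not defined for all times are covered too.
\<close>

definition forward_invariant :: "('a::real_normed_vector \<Rightarrow> 'a) \<Rightarrow> 'a set \<Rightarrow> bool" where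
  "forward_invariant f S \<longleftrightarrow>
     (\<forall>T\<ge>0. \<forall>p. trajectory_on {0..T} f p \<and> p 0 \<in> S \<longrightarrow> (\<forall>t\<in>{0..T}. p t \<in> S))"

definition equilibrium :: "('a::real_normed_vector \<Rightarrow> 'a) \<Rightarrow> 'a \<Rightarrow> bool" where
  "equilibrium f e \<longleftrightarrow> f e = 0"

definition lyapunov_stable :: "('a::real_normed_vector \<Rightarrow> 'a) \<Rightarrow> 'a \<Rightarrow> bool" where
  "lyapunov_stable f e \<longleftrightarrow> (\<forall>\<epsilon>>0. \<exists>\<delta>>0. \<forall>T\<ge>0. \<forall>p.
     trajectory_on {0..T} f p \<and> dist (p 0) e < \<delta> \<longrightarrow> (\<forall>t\<in>{0..T}. dist (p t) e < \<epsilon>))"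

text \<open>Existence of global trajectories is demanded, so that attractivity cannot hold vacuously.\<close>

definition locally_attractive :: "('a::real_normed_vector \<Rightarrow> 'a) \<Rightarrow> 'a \<Rightarrow> bool" where
  "locally_attractive f e \<longleftrightarrow> (\<exists>\<delta>>0. \<forall>p0. dist p0 e < \<delta> \<longrightarrow>
     (\<exists>p. trajectory_on {0..} f p \<and> p 0 = p0) \<and>
     (\<forall>p. trajectory_on {0..} f p \<and> p 0 = p0 \<longrightarrow> (p \<longlongrightarrow> e) at_top))"

definition asymptotically_stable :: "('a::real_normed_vector \<Rightarrow> 'a) \<Rightarrow> 'a \<Rightarrow> bool" where
  "asymptotically_stable f e \<longleftrightarrow> equilibrium f e \<and> lyapunov_stable f e \<and> locally_attractive f e"

end

theory Submission
  imports Defs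
begin

text \<open>
  The loss \<open>\<Phi> (response p) - \<Phi> xd\<close> is a strict Lyapunov function for the incentive dynamics. The
  incentives in \<open>P\<close> are those whose equilibrium is interior, and there the response is the inverse
  of \<open>- G0\<close>; hence its derivative is \<open>- J\<^sup>-\<^sup>1\<close>, where \<open>J\<close> is the Jacobian of \<open>G0\<close>, and along the
  dynamics the loss changes at the rate \<open>- (g \<bullet> J\<^sup>-\<^sup>1 g)\<close>, where \<open>g\<close> is the gradient of \<open>\<Phi>\<close> at the
  response. Strong monotonicity of \<open>G0\<close> and boundedness of \<open>J\<close> make this at most a negative multiple
  of \<open>(norm g)\<^sup>2\<close>, which strong convexity of \<open>\<Phi>\<close> bounds below by a multiple of the loss (the
  Polyak-Lojasiewicz inequality). So the loss decays exponentially as long as the trajectory stays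
  in \<open>P\<close> (\<open>loss_dissipation\<close>, \<open>lyapunov_decay\<close>).

  Below the level \<open>cstar\<close> the sublevel sets of \<open>\<Phi>\<close> do not meet the boundary of \<open>X\<close>. Their images
  under \<open>- G0\<close> are therefore compact subsets of \<open>P\<close>, which is open by invariance of domain, and a
  trajectory that starts in one of them cannot reach the complement of \<open>P\<close>
  (\<open>sublevel_forward_invariant\<close>). Quadratic growth of \<open>\<Phi>\<close> at \<open>xd\<close> turns decay of the loss into
  convergence of the response to \<open>xd\<close>, and continuity of \<open>G0\<close> turns this into convergence of the
  incentive.

  Existence and uniqueness of trajectories rest on the fact that the response is defined for every
  incentive, as the solution of a strongly monotone variational inequality (Brouwer's theorem), and
  is globally Lipschitz. The vector field is then globally Lipschitz too, and one contraction
  argument on the half line gives global trajectories (\<open>lipschitz_global_trajectory\<close>).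
\<close>

section \<open>Trajectories of globally Lipschitz vector fields\<close>

text \<open>
  Gronwall's inequality in differential form: \<open>t \<mapsto> u t * exp (- K * (t - a))\<close> is nonincreasing.
  The constant \<open>K\<close> may be negative, so the same lemma serves uniqueness of trajectories
  (\<open>K > 0\<close>) and exponential decay (\<open>K < 0\<close>).
\<close>

lemma gronwall_differential:
  fixes u u' :: "real \<Rightarrow> real"
  assumes "a \<le> b"
    and deriv: "\<And>t. t \<in> {a..b} \<Longrightarrow> (u has_real_derivative u' t) (at t within {a..b})"
    and le: "\<And>t. t \<in> {a..b} \<Longrightarrow> u' t \<le> K * u t"
  shows "u b \<le> u a * exp (K * (b - a))"
proof -
  define h where "h t = u t * exp (- K * (t - a))" for t
  have "(h has_derivative (*) ((u' t - K * u t) * exp (- K * (t - a)))) (at t within {a..b})"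
    if "a \<le> t" "t \<le> b" for t
    unfolding h_def has_field_derivative_def[symmetric]
    using that by (auto intro!: derivative_eq_intros deriv simp: algebra_simps)
  from mvt_very_simple[OF \<open>a \<le> b\<close> this]
  obtain t where t: "t \<in> {a..b}"
    and "h b - h a = (u' t - K * u t) * exp (- K * (t - a)) * (b - a)"
    by blast
  moreover have "(u' t - K * u t) * exp (- K * (t - a)) * (b - a) \<le> 0"
    using le[OF t] \<open>a \<le> b\<close> by (intro mult_nonpos_nonneg) auto
  ultimately have "u b * exp (- K * (b - a)) \<le> u a"
    by (simp add: h_def)
  then have "u b * exp (- K * (b - a)) * exp (K * (b - a)) \<le> u a * exp (K * (b - a))"
    by (intro mult_right_mono) auto
  then show ?thesis
    by (simp add: mult.assoc flip: exp_add)
qed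

lemma trajectory_on_subset:
  "trajectory_on J f p \<Longrightarrow> I \<subseteq> J \<Longrightarrow> trajectory_on I f p"
  unfolding trajectory_on_def by (meson has_vector_derivative_within_subset subsetD)

lemma trajectory_on_continuous:
  "trajectory_on J f p \<Longrightarrow> continuous_on J p"
  unfolding trajectory_on_def continuous_on_eq_continuous_within
  by (meson has_vector_derivative_continuous)

text \<open>
  The squared distance of two trajectories grows at most at the exponential rate \<open>2 * L\<close>, and it
  starts from zero.
\<close>

lemma trajectory_unique:
  fixes f :: "'a::real_inner \<Rightarrow> 'a"
  assumes f: "L-lipschitz_on UNIV f"
    and p: "trajectory_on {0..} f p" and q: "trajectory_on {0..} f q"
    and "p 0 = q 0" "0 \<le> t"
  shows "p t = q t"
proof -
  define u where "u s = (p s - q s) \<bullet> (p s - q s)" for s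
  have "u t \<le> u 0 * exp (2 * L * (t - 0))"
  proof (rule gronwall_differential[OF \<open>0 \<le> t\<close>])
    fix s assume s: "s \<in> {0..t}"
    then have "(p has_vector_derivative f (p s)) (at s within {0..t})"
      "(q has_vector_derivative f (q s)) (at s within {0..t})"
      using trajectory_on_subset[OF p, of "{0..t}"] trajectory_on_subset[OF q, of "{0..t}"]
      by (auto simp: trajectory_on_def)
    then show "(u has_real_derivative 2 * ((p s - q s) \<bullet> (f (p s) - f (q s)))) (at s within {0..t})"
      unfolding u_def has_vector_derivative_def has_field_derivative_def
      by (auto intro!: derivative_eq_intros
          simp: fun_eq_iff algebra_simps inner_commute)
    have "(p s - q s) \<bullet> (f (p s) - f (q s)) \<le> norm (p s - q s) * norm (f (p s) - f (q s))"
      by (rule norm_cauchy_schwarz)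
    also have "\<dots> \<le> norm (p s - q s) * (L * norm (p s - q s))"
      using lipschitz_onD[OF f, of "p s" "q s"] by (intro mult_left_mono) (auto simp: dist_norm)
    also have "\<dots> = L * u s"
      by (simp add: u_def dot_square_norm power2_eq_square)
    finally show "2 * ((p s - q s) \<bullet> (f (p s) - f (q s))) \<le> 2 * L * u s"
      by simp
  qed
  then have "u t \<le> 0"
    using \<open>p 0 = q 0\<close> by (simp add: u_def)
  then show ?thesis
    by (simp add: u_def dot_square_norm)
qed

lemma integral_has_vector_derivative_atLeast:
  fixes h :: "real \<Rightarrow> 'a::banach"
  assumes "continuous_on {a..} h" "a \<le> t"
  shows "((\<lambda>t. integral {a..t} h) has_vector_derivative h t) (at t within {a..})"
proof -
  have "((\<lambda>t. integral {a..t} h) has_vector_derivative h t) (at t within {a..t + 1})"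
    using assms by (intro integral_has_vector_derivative) (auto intro: continuous_on_subset)
  moreover have "at t within {a..t + 1} = at t within {a..}"
    by (rule at_within_nhd[of _ "{..<t + 1}"]) auto
  ultimately show ?thesis
    by simp
qed

text \<open>
  Damping by the weight gains the factor \<open>1 / \<beta>\<close>; this is what makes the Picard operator below a
  contraction on the whole half line.
\<close>

lemma norm_integral_le_exp:
  fixes h :: "real \<Rightarrow> 'a::banach"
  assumes cont: "continuous_on {0..} h" and "0 \<le> C" "0 < \<beta>"
    and bound: "\<And>s. 0 \<le> s \<Longrightarrow> norm (h s) \<le> C * exp (\<beta> * s)"
  shows "norm (exp (- \<beta> * t) *\<^sub>R integral {0..t} h) \<le> C / \<beta>"
proof (cases "0 \<le> t")
  case True
  have exp_int: "((\<lambda>s. C * exp (\<beta> * s)) has_integral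
      C * exp (\<beta> * t) / \<beta> - C * exp (\<beta> * 0) / \<beta>) {0..t}"
    using \<open>0 < \<beta>\<close> True
    by (intro fundamental_theorem_of_calculus)
       (auto intro!: derivative_eq_intros simp flip: has_real_derivative_iff_has_vector_derivative)
  have "norm (integral {0..t} h) \<le> integral {0..t} (\<lambda>s. C * exp (\<beta> * s))"
  proof (rule integral_norm_bound_integral)
    show "h integrable_on {0..t}"
      using cont by (intro integrable_continuous_real) (auto intro: continuous_on_subset)
    show "(\<lambda>s. C * exp (\<beta> * s)) integrable_on {0..t}"
      using exp_int by blast
    show "norm (h s) \<le> C * exp (\<beta> * s)" if "s \<in> {0..t}" for s
      using bound that by simp
  qed
  also have "\<dots> \<le> C / \<beta> * exp (\<beta> * t)"
    using integral_unique[OF exp_int] \<open>0 \<le> C\<close> \<open>0 < \<beta>\<close> by simp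
  finally have "exp (- \<beta> * t) * norm (integral {0..t} h)
      \<le> exp (- \<beta> * t) * (C / \<beta> * exp (\<beta> * t))"
    by (intro mult_left_mono) auto
  then show ?thesis
    by (simp add: mult.left_commute[of "exp _"] flip: exp_add)
next
  case False
  then show ?thesis
    using assms by simp
qed

text \<open>
  Picard iteration in a weighted supremum norm. With \<open>p t = p0 + exp (\<beta> * t) *\<^sub>R v t\<close> the integral
  equation for \<open>p\<close> becomes a fixed point equation for the bounded function \<open>v\<close>, whose operator is a
  contraction with constant \<open>L / \<beta>\<close>. Hence a single application of the Banach fixed point theorem
  yields a trajectory for all times.
\<close>

lemma lipschitz_global_trajectory:
  fixes f :: "'a::banach \<Rightarrow> 'a"
  assumes f: "L-lipschitz_on UNIV f"
  obtains p where "trajectory_on {0..} f p" "p 0 = p0"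
proof -
  have "0 \<le> L"
    using f by (rule lipschitz_on_nonneg)
  \<comment> \<open>Any weight above \<open>L\<close> gives a contraction.\<close>
  define \<beta> where "\<beta> = L + 1"
  have "0 < \<beta>" "L / \<beta> < 1" "0 \<le> L / \<beta>"
    using \<open>0 \<le> L\<close> by (auto simp: \<beta>_def)
  define h where "h v s = f (p0 + exp (\<beta> * s) *\<^sub>R apply_bcontfun v s)" for v and s :: real
  have cont_f: "continuous_on UNIV f"
    using f by (rule lipschitz_on_continuous_on)
  have cont_h: "continuous_on S (h v)" for v S
    unfolding h_def
    by (intro continuous_on_compose2[OF cont_f] continuous_intros continuous_on_apply_bcontfun) auto
  define S where "S v t = exp (- \<beta> * t) *\<^sub>R integral {0..t} (h v)" for v and t :: real
  have int_deriv: "((\<lambda>t. integral {0..t} (h v)) has_vector_derivative h v t) (at t within {0..})"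
    if "0 \<le> t" for v t
    using cont_h that by (rule integral_has_vector_derivative_atLeast)
  have "S v \<in> bcontfun" for v
  proof (rule bcontfun_normI)
    have "continuous_on {0..} (\<lambda>t. integral {0..t} (h v))"
      using int_deriv has_vector_derivative_continuous
      by (force simp: continuous_on_eq_continuous_within)
    then have "continuous_on {0..} (S v)"
      unfolding S_def by (intro continuous_intros)
    \<comment> \<open>For negative \<open>t\<close> the interval of integration is empty, so \<open>S v\<close> continues by \<open>0\<close>.\<close>
    moreover have "continuous_on {..0} (S v)"
      by (rule continuous_on_cong[THEN iffD1, OF refl _ continuous_on_const[of _ 0]])
         (auto simp: S_def dest: le_imp_less_or_eq)
    ultimately have "continuous_on ({0..} \<union> {..0}) (S v)"
      by (intro continuous_on_closed_Un) auto
    moreover have "{0..} \<union> {..0} = (UNIV :: real set)"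
      by auto
    ultimately show "continuous_on UNIV (S v)"
      by simp
    fix t
    show "norm (S v t) \<le> (norm (f p0) + L * norm v) / \<beta>"
      unfolding S_def
    proof (rule norm_integral_le_exp[OF cont_h _ \<open>0 < \<beta>\<close>])
      fix s :: real assume "0 \<le> s"
      have "norm (h v s - f p0) \<le> L * norm (exp (\<beta> * s) *\<^sub>R apply_bcontfun v s)"
        using lipschitz_onD[OF f, of "p0 + exp (\<beta> * s) *\<^sub>R apply_bcontfun v s" p0]
        by (simp add: h_def dist_norm)
      also have "\<dots> \<le> L * (exp (\<beta> * s) * norm v)"
        using \<open>0 \<le> L\<close> norm_bounded[of v s] by (intro mult_left_mono) auto
      finally have "norm (h v s) \<le> norm (f p0) * 1 + L * (exp (\<beta> * s) * norm v)"
        using norm_triangle_sub[of "h v s" "f p0"] by simp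
      also have "\<dots> \<le> norm (f p0) * exp (\<beta> * s) + L * (exp (\<beta> * s) * norm v)"
        using \<open>0 \<le> s\<close> \<open>0 < \<beta>\<close> by (intro add_right_mono mult_left_mono) auto
      finally show "norm (h v s) \<le> (norm (f p0) + L * norm v) * exp (\<beta> * s)"
        by (simp add: algebra_simps)
    qed (use \<open>0 \<le> L\<close> in auto)
  qed
  note S_in = this
  have S_contraction: "dist (Bcontfun (S v)) (Bcontfun (S w)) \<le> L / \<beta> * dist v w" for v w
  proof (rule dist_bound)
    fix t
    have int: "h u integrable_on {0..t}" for u
      using cont_h by (rule integrable_continuous_real)
    have "norm (exp (- \<beta> * t) *\<^sub>R integral {0..t} (\<lambda>s. h v s - h w s)) \<le> (L * dist v w) / \<beta>"
    proof (rule norm_integral_le_exp[OF _ _ \<open>0 < \<beta>\<close>])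
      fix s :: real
      have "norm (h v s - h w s) \<le> L * (exp (\<beta> * s) * dist (apply_bcontfun v s) (apply_bcontfun w s))"
        using lipschitz_onD[OF f, of "p0 + exp (\<beta> * s) *\<^sub>R apply_bcontfun v s"
            "p0 + exp (\<beta> * s) *\<^sub>R apply_bcontfun w s"]
        by (simp add: h_def dist_norm flip: scaleR_diff_right)
      also have "\<dots> \<le> L * (exp (\<beta> * s) * dist v w)"
        using \<open>0 \<le> L\<close> dist_bounded[of v s w] by (intro mult_left_mono) auto
      finally show "norm (h v s - h w s) \<le> (L * dist v w) * exp (\<beta> * s)"
        by (simp add: algebra_simps)
    qed (use \<open>0 \<le> L\<close> in \<open>auto intro!: continuous_intros cont_h\<close>)
    then show "dist (apply_bcontfun (Bcontfun (S v)) t) (apply_bcontfun (Bcontfun (S w)) t)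
        \<le> L / \<beta> * dist v w"
      using int by (simp add: Bcontfun_inverse S_in S_def dist_norm Henstock_Kurzweil_Integration.integral_diff
          flip: scaleR_diff_right)
  qed
  then obtain v where "Bcontfun (S v) = v"
    using banach_fix_type[OF \<open>0 \<le> L / \<beta>\<close> \<open>L / \<beta> < 1\<close>, of "\<lambda>v. Bcontfun (S v)"] by blast
  then have v: "apply_bcontfun v t = S v t" for t
    by (metis Bcontfun_inverse S_in)
  define p where "p t = p0 + integral {0..t} (h v)" for t
  have "p t = p0 + exp (\<beta> * t) *\<^sub>R apply_bcontfun v t" for t
    by (simp add: p_def v S_def flip: exp_add)
  then have "h v t = f (p t)" for t
    by (simp add: h_def)
  moreover have "(p has_vector_derivative h v t) (at t within {0..})" if "0 \<le> t" for t
    using has_vector_derivative_add[OF has_vector_derivative_const int_deriv[OF that]]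
    by (simp add: p_def[abs_def])
  ultimately have "trajectory_on {0..} f p"
    by (simp add: trajectory_on_def)
  then show thesis
    by (rule that) (simp add: p_def)
qed

section \<open>Lyapunov functions\<close>

text \<open>With \<open>\<kappa> = 0\<close> this says that \<open>V\<close> does not increase.\<close>

lemma lyapunov_decay:
  fixes f :: "'a::real_normed_vector \<Rightarrow> 'a" and V :: "'a \<Rightarrow> real"
  assumes V: "\<And>p. p \<in> P \<Longrightarrow> (V has_derivative V' p) (at p)"
    and decay: "\<And>p. p \<in> P \<Longrightarrow> V' p (f p) \<le> - \<kappa> * V p"
    and traj: "trajectory_on {0..T} f p" and "0 \<le> T"
    and P: "\<And>t. t \<in> {0..T} \<Longrightarrow> p t \<in> P"
  shows "V (p T) \<le> V (p 0) * exp (- \<kappa> * T)"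
proof -
  have "V (p T) \<le> V (p 0) * exp (- \<kappa> * (T - 0))"
  proof (rule gronwall_differential[OF \<open>0 \<le> T\<close>])
    fix t assume t: "t \<in> {0..T}"
    have "(p has_vector_derivative f (p t)) (at t within {0..T})"
      using traj t by (simp add: trajectory_on_def)
    from vector_derivative_diff_chain_within[OF this has_derivative_at_withinI[OF V[OF P[OF t]]]]
    show "((\<lambda>t. V (p t)) has_real_derivative V' (p t) (f (p t))) (at t within {0..T})"
      by (simp add: has_real_derivative_iff_has_vector_derivative o_def)
    show "V' (p t) (f (p t)) \<le> - \<kappa> * V (p t)"
      by (rule decay[OF P[OF t]])
  qed
  then show ?thesis
    by simp
qed

text \<open>
  \<open>V\<close> is only controlled on the open set \<open>P\<close>, so it has to be excluded that a trajectory leaves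
  \<open>P\<close>. Before the first exit time \<open>V\<close> does not increase, hence the trajectory is in the sublevel
  set; as this set is closed, the trajectory is in it, and so in \<open>P\<close>, at the exit time too.
\<close>

lemma sublevel_forward_invariant:
  fixes f :: "'a::real_normed_vector \<Rightarrow> 'a" and V :: "'a \<Rightarrow> real"
  assumes V: "\<And>p. p \<in> P \<Longrightarrow> (V has_derivative V' p) (at p)"
    and decr: "\<And>p. p \<in> P \<Longrightarrow> V' p (f p) \<le> 0"
    and "open P" and cl: "closed {p \<in> P. V p \<le> c}"
  shows "forward_invariant f {p \<in> P. V p \<le> c}"
  unfolding forward_invariant_def
proof (intro allI impI ballI)
  fix T t :: real and p
  assume "0 \<le> T" and p: "trajectory_on {0..T} f p \<and> p 0 \<in> {p \<in> P. V p \<le> c}" and t: "t \<in> {0..T}"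
  have cont: "continuous_on {0..T} p"
    using p trajectory_on_continuous by blast
  have stays: "V (p s) \<le> c" if "s \<in> {0..T}" "\<And>r. r \<in> {0..s} \<Longrightarrow> p r \<in> P" for s
    using lyapunov_decay[of P V V' f 0 s p, OF V _ _ _ that(2)] decr p that(1)
      trajectory_on_subset[of "{0..T}" f p "{0..s}"] by force
  have in_P: "p s \<in> P" if "s \<in> {0..T}" for s
  proof (rule ccontr)
    define B where "B = {s \<in> {0..T}. p s \<in> - P}"
    assume "p s \<notin> P"
    then have "B \<noteq> {}"
      using that by (auto simp: B_def)
    moreover have "compact B"
    proof -
      have "closed B"
        using continuous_closed_preimage[OF cont, of "- P"] \<open>open P\<close>
        by (simp add: B_def vimage_def Int_def closed_Compl)
      moreover have "B \<subseteq> {0..T}"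
        by (auto simp: B_def)
      ultimately show ?thesis
        using bounded_subset[OF bounded_closed_interval]
        by (simp add: compact_eq_bounded_closed) blast
    qed
    ultimately obtain \<tau> where \<tau>: "\<tau> \<in> B" "\<forall>s\<in>B. \<tau> \<le> s"
      using compact_attains_inf[of B] by metis
    then have \<tau>_bounds: "0 \<le> \<tau>" "\<tau> \<le> T" "p \<tau> \<notin> P"
      by (auto simp: B_def)
    moreover have "\<tau> \<noteq> 0"
      using p \<tau>_bounds by auto
    ultimately have "0 < \<tau>"
      by simp
    have before: "p r \<in> P" if "0 \<le> r" "r < \<tau>" for r
      using that bspec[OF \<tau>(2), of r] \<tau>_bounds by (auto simp: B_def)
    have "continuous_on (closure {0<..<\<tau>}) p"
      using cont \<open>0 < \<tau>\<close> \<tau>_bounds by (auto intro: continuous_on_subset)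
    moreover have "p ` {0<..<\<tau>} \<subseteq> {p \<in> P. V p \<le> c}"
      using before stays \<tau>_bounds by auto
    ultimately have "p ` closure {0<..<\<tau>} \<subseteq> {p \<in> P. V p \<le> c}"
      using cl by (intro image_closure_subset)
    moreover have "\<tau> \<in> closure {0<..<\<tau>}"
      using \<open>0 < \<tau>\<close> by simp
    ultimately show False
      using \<tau>_bounds(3) by blast
  qed
  show "p t \<in> {p \<in> P. V p \<le> c}"
    using in_P stays[OF t] t by auto
qed

section \<open>The response map and its dissipation inequality\<close>

text \<open>
  The game enters only through its pseudo-gradient \<open>G0\<close> with Jacobian \<open>J\<close>. Coercivity of \<open>J\<close> is the
  lower bound on its symmetric part, and \<open>M\<close> bounds its operator norm; \<open>\<alpha>\<close>, \<open>M\<close> and \<open>\<mu>\<close> together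
  determine the rate of convergence.
\<close>

locale incentive_design =
  fixes X :: "(real^'n) set"
    and G0 :: "real^'n \<Rightarrow> real^'n" and J :: "real^'n \<Rightarrow> real^'n^'n"
    and \<Phi> :: "real^'n \<Rightarrow> real" and xd :: "real^'n" and \<alpha> M \<mu> L :: real
  assumes compact_X: "compact X" and convex_X: "convex X"
    and G0_deriv: "\<And>x. x \<in> X \<Longrightarrow> (G0 has_derivative (*v) (J x)) (at x within X)"
    and \<alpha>_pos: "0 < \<alpha>" and M_pos: "0 < M" and \<mu>_pos: "0 < \<mu>"
    and J_coercive: "\<And>x v. x \<in> X \<Longrightarrow> \<alpha> * (norm v)\<^sup>2 \<le> v \<bullet> (J x *v v)"
    and J_bounded: "\<And>x v. x \<in> X \<Longrightarrow> norm (J x *v v) \<le> M * norm v"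
    and \<Phi>_deriv: "\<And>x. x \<in> X \<Longrightarrow> (\<Phi> has_derivative (\<bullet>) (gradient_on X \<Phi> x)) (at x within X)"
    and \<Phi>_convex: "strongly_convex_on \<mu> X \<Phi>"
    and \<Phi>_lipschitz: "L-lipschitz_on X (gradient_on X \<Phi>)"
    and \<Phi>_min: "\<And>x. x \<in> X \<Longrightarrow> \<Phi> xd \<le> \<Phi> x"
    and xd_interior: "xd \<in> interior X"
begin

abbreviation "grad \<equiv> gradient_on X \<Phi>"
abbreviation "nash \<equiv> incentivized_nash X G0"
abbreviation "resp \<equiv> response X G0"
abbreviation "P \<equiv> incentives X G0"
abbreviation "field \<equiv> incentive_field X G0 \<Phi>"

text \<open>The suboptimality of the response, which serves as Lyapunov function on \<open>P\<close>.\<close>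

definition loss :: "real^'n \<Rightarrow> real" where
  "loss p = \<Phi> (resp p) - \<Phi> xd"

lemma xd_in: "xd \<in> X"
  using xd_interior interior_subset by blast

lemma G0_continuous: "continuous_on X G0"
  using G0_deriv by (intro has_derivative_continuous_on)

lemma \<Phi>_continuous: "continuous_on X \<Phi>"
  using \<Phi>_deriv by (intro has_derivative_continuous_on)

text \<open>Coercivity of \<open>J\<close> is integrated along the segment from \<open>x\<close> to \<open>y\<close>.\<close>

lemma G0_strongly_monotone:
  assumes "x \<in> X" "y \<in> X"
  shows "\<alpha> * (norm (y - x))\<^sup>2 \<le> (G0 y - G0 x) \<bullet> (y - x)"
proof -
  define z where "z s = x + s *\<^sub>R (y - x)" for s :: real
  have z_in: "z s \<in> X" if "0 \<le> s" "s \<le> 1" for s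
    using convexD_alt[OF convex_X assms, of s] that by (simp add: z_def algebra_simps)
  have "((\<lambda>s. G0 (z s) \<bullet> (y - x)) has_derivative (\<lambda>h. h * ((J (z s) *v (y - x)) \<bullet> (y - x))))
      (at s within {0..1})" if "0 \<le> s" "s \<le> 1" for s
  proof -
    have "(z has_vector_derivative (y - x)) (at s within {0..1})"
      unfolding z_def by (auto intro!: derivative_eq_intros)
    moreover have "(G0 has_derivative (*v) (J (z s))) (at (z s) within z ` {0..1})"
      by (rule has_derivative_subset[OF G0_deriv]) (use z_in that in auto)
    ultimately have "(G0 \<circ> z has_vector_derivative J (z s) *v (y - x)) (at s within {0..1})"
      by (rule vector_derivative_diff_chain_within)
    then show ?thesis
      unfolding has_vector_derivative_def
      by (auto intro!: derivative_eq_intros simp: o_def)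
  qed
  from mvt_very_simple[OF _ this] obtain s where "s \<in> {0..1}"
    and "G0 (z 1) \<bullet> (y - x) - G0 (z 0) \<bullet> (y - x) = (J (z s) *v (y - x)) \<bullet> (y - x)"
    by auto
  then show ?thesis
    using J_coercive[of "z s" "y - x"] z_in[of s]
    by (simp add: z_def inner_diff_left[of "G0 y"] inner_commute[of "_ *v _"])
qed

text \<open>
  A fixed point of the projected gradient step \<open>x \<mapsto> proj (x - (G0 x + p))\<close> solves the variational
  inequality, because the residual of a projection onto a convex set is normal to this set.
\<close>

lemma nash_exists: "\<exists>x. nash p x"
proof -
  define F where "F x = closest_point X (x - (G0 x + p))" for x
  have X: "closed X" "X \<noteq> {}"
    using compact_X xd_in by (auto intro: compact_imp_closed)
  have "continuous_on X F"
    unfolding F_def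
    by (rule continuous_on_compose2[OF continuous_on_closest_point[OF convex_X X]])
       (auto intro!: continuous_intros G0_continuous)
  moreover have "F \<in> X \<rightarrow> X"
    using closest_point_in_set[OF X] by (auto simp: F_def)
  ultimately obtain x where x: "x \<in> X" "F x = x"
    using brouwer[OF compact_X convex_X X(2)] by blast
  have "0 \<le> (G0 x + p) \<bullet> (y - x)" if "y \<in> X" for y
    using closest_point_dot[OF convex_X X(1) that, of "x - (G0 x + p)"] x(2)
    by (simp add: F_def inner_diff_left inner_add_left)
  then show ?thesis
    using x(1) by (auto simp: incentivized_nash_def incentivized_pseudo_gradient_def)
qed

text \<open>
  The two variational inequalities are tested against each other's solution and added; strong
  monotonicity bounds the sum from below. The case \<open>p = q\<close> is uniqueness.
\<close>

lemma nash_lipschitz: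
  assumes "nash p x" "nash q y"
  shows "\<alpha> * dist x y \<le> dist p q"
proof (cases "x = y")
  case False
  have "0 \<le> (G0 x + p) \<bullet> (y - x)" "0 \<le> (G0 y + q) \<bullet> (x - y)" and X: "x \<in> X" "y \<in> X"
    using assms by (auto simp: incentivized_nash_def incentivized_pseudo_gradient_def)
  then have "(G0 y - G0 x) \<bullet> (y - x) \<le> (p - q) \<bullet> (y - x)"
    by (simp add: algebra_simps)
  also have "\<dots> \<le> norm (p - q) * norm (y - x)"
    by (rule norm_cauchy_schwarz)
  finally have "\<alpha> * (norm (y - x))\<^sup>2 \<le> norm (p - q) * norm (y - x)"
    using G0_strongly_monotone[OF X] by simp
  then show ?thesis
    using False by (simp add: power2_eq_square dist_norm norm_minus_commute)
qed simp

lemma nash_response: "nash p (resp p)"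
proof -
  obtain x where "nash p x"
    using nash_exists by blast
  moreover have "y = x" if "nash p y" for y
    using nash_lipschitz[OF that \<open>nash p x\<close>] \<alpha>_pos by (simp add: mult_le_0_iff)
  ultimately show ?thesis
    unfolding response_def by (rule theI)
qed

lemma response_eqI: "nash p x \<Longrightarrow> resp p = x"
  using nash_lipschitz[of p "resp p" p x] nash_response[of p] \<alpha>_pos by (simp add: mult_le_0_iff)

lemma response_in: "resp p \<in> X"
  using nash_response by (auto simp: incentivized_nash_def)

lemma response_lipschitz: "(1 / \<alpha>)-lipschitz_on UNIV resp"
  using nash_lipschitz[OF nash_response nash_response] \<alpha>_pos
  by (intro lipschitz_onI) (auto simp: field_simps)

lemma response_continuous: "continuous_on S resp"
  using lipschitz_on_continuous_on[OF response_lipschitz] continuous_on_subset by blast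

lemma response_uminus_G0: "x \<in> X \<Longrightarrow> resp (- G0 x) = x"
  by (rule response_eqI) (simp add: incentivized_nash_def incentivized_pseudo_gradient_def)

lemma response_interior: "p \<in> P \<Longrightarrow> resp p \<in> interior X"
  using response_uminus_G0 interior_subset by (fastforce simp: incentives_def)

lemma G0_response: "p \<in> P \<Longrightarrow> - G0 (resp p) = p"
  using response_uminus_G0 interior_subset by (fastforce simp: incentives_def)

text \<open>
  As the response is defined and Lipschitz for all incentives, the vector field is Lipschitz on the
  whole space and not only on \<open>P\<close>. This makes the trajectories global and unique.
\<close>

lemma field_lipschitz: "(L * (1 / \<alpha>))-lipschitz_on UNIV field"
proof -
  have "(L * (1 / \<alpha>))-lipschitz_on UNIV (\<lambda>p. grad (resp p))"
    by (rule lipschitz_on_compose2[OF response_lipschitz])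
       (rule lipschitz_on_subset[OF \<Phi>_lipschitz], use response_in in auto)
  then show ?thesis
    by (simp add: incentive_field_def[abs_def])
qed

lemma open_incentives: "open P"
  unfolding incentives_def
proof (rule invariance_of_domain)
  show "continuous_on (interior X) (\<lambda>x. - G0 x)"
    by (intro continuous_intros continuous_on_subset[OF G0_continuous] interior_subset)
  show "inj_on (\<lambda>x. - G0 x) (interior X)"
    by (rule inj_on_inverseI[of _ resp]) (use response_uminus_G0 interior_subset in blast)
qed simp

text \<open>On \<open>P\<close> the response inverts \<open>- G0\<close>, so its derivative is given by the inverse of \<open>- J\<close>.\<close>

lemma response_has_derivative:
  assumes "p \<in> P"
  obtains R where "(resp has_derivative R) (at p)" "\<And>w. J (resp p) *v R w = - w"
proof -
  define x where "x = resp p"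
  have x: "x \<in> interior X" "x \<in> X"
    using response_interior[OF assms] response_in by (auto simp: x_def)
  have "v = 0" if "J x *v v = 0" for v
    using J_coercive[OF x(2), of v] that \<alpha>_pos by (simp add: mult_le_0_iff)
  then obtain B where B: "B ** J x = mat 1"
    using matrix_left_invertible_ker[of "J x"] by blast
  then have B': "J x ** B = mat 1"
    by (rule matrix_left_right_inverse[THEN iffD1])
  have "(resp has_derivative (\<lambda>w. - (B *v w))) (at p)"
  proof (rule has_derivative_inverse_basic[where T = P])
    have "(G0 has_derivative (*v) (J x)) (at x)"
      using G0_deriv[OF x(2)] by (simp only: at_within_interior[OF x(1)])
    from has_derivative_minus[OF this]
    show "((\<lambda>x. - G0 x) has_derivative (\<lambda>v. - (J x *v v))) (at (resp p))"
      by (simp only: x_def)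
    show "bounded_linear (\<lambda>w. - (B *v w))"
      by (intro bounded_linear_minus matrix_vector_mul_bounded_linear)
    show "(\<lambda>w. - (B *v w)) \<circ> (\<lambda>v. - (J x *v v)) = id"
      using B by (simp add: fun_eq_iff linear_neg[OF matrix_vector_mul_linear]
          matrix_vector_mul_assoc)
    show "continuous (at p) resp"
      using response_continuous[of UNIV] by (simp add: continuous_on_eq_continuous_at)
  qed (use open_incentives assms G0_response in auto)
  moreover have "J x *v (- (B *v w)) = - w" for w
    using B' by (simp add: linear_neg[OF matrix_vector_mul_linear] matrix_vector_mul_assoc)
  ultimately show thesis
    using that unfolding x_def by blast
qed

text \<open>
  The Polyak-Lojasiewicz inequality: minimise the quadratic lower bound of \<open>\<Phi> xd\<close> given by strong
  convexity over the displacement.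
\<close>

lemma gradient_dominates_loss:
  assumes "x \<in> X"
  shows "2 * \<mu> * (\<Phi> x - \<Phi> xd) \<le> (norm (grad x))\<^sup>2"
proof -
  have "\<Phi> x - \<Phi> xd \<le> - (grad x \<bullet> (xd - x)) - \<mu> / 2 * (norm (xd - x))\<^sup>2"
    using \<Phi>_convex assms xd_in unfolding strongly_convex_on_def by force
  then have "2 * \<mu> * (\<Phi> x - \<Phi> xd)
      \<le> 2 * \<mu> * (- (grad x \<bullet> (xd - x)) - \<mu> / 2 * (norm (xd - x))\<^sup>2)"
    using \<mu>_pos by (intro mult_left_mono) auto
  also have "\<dots> = (norm (grad x))\<^sup>2 - (norm (grad x + \<mu> *\<^sub>R (xd - x)))\<^sup>2"
    unfolding power2_norm_eq_inner inner_add_left inner_add_right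
    by (simp add: inner_commute algebra_simps power2_eq_square)
  finally show ?thesis
    using zero_le_power2[of "norm (grad x + \<mu> *\<^sub>R (xd - x))"] by linarith
qed

lemma loss_nonneg: "0 \<le> loss p"
  using \<Phi>_min[OF response_in] by (simp add: loss_def)

text \<open>The exponential rate at which the loss decays along trajectories in \<open>P\<close>.\<close>

definition \<kappa> :: real where "\<kappa> = 2 * \<mu> * \<alpha> / M\<^sup>2"

lemma \<kappa>_pos: "0 < \<kappa>"
  using \<alpha>_pos \<mu>_pos M_pos by (simp add: \<kappa>_def)

text \<open>
  With \<open>g\<close> the gradient of \<open>\<Phi>\<close> at the response and \<open>y = R g\<close>, where \<open>R\<close> is the derivative of the
  response, \<open>g = - J y\<close>. So the loss changes at the rate \<open>g \<bullet> y = - (y \<bullet> J y)\<close>, which is at most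
  \<open>- \<alpha> * (norm y)\<^sup>2\<close> by monotonicity, while \<open>norm g \<le> M * norm y\<close>; the
  Polyak-Lojasiewicz inequality turns this into a bound by the loss itself.
\<close>

lemma loss_dissipation:
  assumes "p \<in> P"
  obtains V' where "(loss has_derivative V') (at p)" "V' (field p) \<le> - \<kappa> * loss p"
proof -
  obtain R where R: "(resp has_derivative R) (at p)" "\<And>w. J (resp p) *v R w = - w"
    using response_has_derivative[OF assms] by blast
  define x where "x = resp p"
  have x: "x \<in> interior X" "x \<in> X"
    using response_interior[OF assms] response_in by (auto simp: x_def)
  define y where "y = R (grad x)"
  have "(\<Phi> has_derivative (\<bullet>) (grad x)) (at x)"
    using \<Phi>_deriv[OF x(2)] by (simp only: at_within_interior[OF x(1)])
  from diff_chain_at[OF R(1) this[unfolded x_def]]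
  have "((\<lambda>p. \<Phi> (resp p)) has_derivative (\<lambda>w. grad x \<bullet> R w)) (at p)"
    by (simp add: o_def x_def)
  then have "(loss has_derivative (\<lambda>w. grad x \<bullet> R w)) (at p)"
    unfolding loss_def[abs_def] by (auto intro!: derivative_eq_intros)
  moreover have "grad x \<bullet> R (field p) \<le> - \<kappa> * loss p"
  proof -
    have Jy: "J x *v y = - grad x"
      by (simp add: y_def x_def R(2))
    have "2 * \<mu> * loss p \<le> (norm (grad x))\<^sup>2"
      using gradient_dominates_loss[OF x(2)] by (simp add: loss_def x_def)
    also have "\<dots> \<le> (M * norm y)\<^sup>2"
      using J_bounded[OF x(2), of y] Jy by (intro power_mono) auto
    also have "\<dots> = M\<^sup>2 / \<alpha> * (\<alpha> * (norm y)\<^sup>2)"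
      using \<alpha>_pos by (simp add: power_mult_distrib)
    also have "\<dots> \<le> M\<^sup>2 / \<alpha> * (- (grad x \<bullet> y))"
      using J_coercive[OF x(2), of y] \<alpha>_pos Jy
      by (intro mult_left_mono) (auto simp: inner_commute)
    finally have "\<alpha> / M\<^sup>2 * (2 * \<mu> * loss p) \<le> \<alpha> / M\<^sup>2 * (M\<^sup>2 / \<alpha> * (- (grad x \<bullet> y)))"
      using \<alpha>_pos by (intro mult_left_mono) auto
    then show ?thesis
      using \<alpha>_pos M_pos by (simp add: \<kappa>_def y_def incentive_field_def x_def mult_ac)
  qed
  ultimately show thesis
    by (rule that)
qed

end

section \<open>Sublevel sets and asymptotic stability\<close>

context incentive_design
begin

abbreviation "Psub \<equiv> incentive_sublevel X G0 \<Phi> xd"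

text \<open>The excess of the least boundary value of \<open>\<Phi>\<close> over its minimum: the constant \<open>cstar\<close>.\<close>

definition gap :: real where
  "gap = (INF x\<in>frontier X. \<Phi> x) - \<Phi> xd"

lemma incentive_sublevel_eq: "Psub c = {p \<in> P. loss p \<le> c}"
  by (simp add: incentive_sublevel_def loss_def)

lemma loss_continuous: "continuous_on UNIV loss"
  unfolding loss_def[abs_def]
  by (intro continuous_on_diff continuous_on_const
      continuous_on_compose2[OF \<Phi>_continuous response_continuous])
     (use response_in in auto)

lemma grad_xd: "grad xd = 0"
proof -
  have "(\<Phi> has_derivative (\<bullet>) (grad xd)) (at xd)"
    using \<Phi>_deriv[OF xd_in] by (simp only: at_within_interior[OF xd_interior])
  then have "(\<bullet>) (grad xd) = (\<lambda>v. 0)"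
    using \<Phi>_min interior_subset
    by (intro differential_zero_maxmin[OF xd_interior open_interior]) blast+
  then have "grad xd \<bullet> grad xd = 0"
    by metis
  then show ?thesis
    by simp
qed

lemma quadratic_growth:
  assumes "x \<in> X"
  shows "\<mu> / 2 * (norm (x - xd))\<^sup>2 \<le> \<Phi> x - \<Phi> xd"
  using \<Phi>_convex assms xd_in grad_xd unfolding strongly_convex_on_def by force

text \<open>
  The minimum over the compact boundary is attained away from the interior point \<open>xd\<close>, so quadratic
  growth makes it larger than \<open>\<Phi> xd\<close>.
\<close>

lemma gap_pos: "0 < gap"
proof -
  have X: "closed X" "bounded X"
    using compact_X by (auto simp: compact_eq_bounded_closed)
  have "frontier X \<noteq> {}"
    using xd_in X(2) not_bounded_UNIV by (intro frontier_not_empty) auto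
  moreover have "compact (frontier X)" "frontier X \<subseteq> X"
    using compact_X X(1) by (auto simp: compact_frontier frontier_subset_closed)
  ultimately obtain x where x: "x \<in> frontier X" "\<forall>y\<in>frontier X. \<Phi> x \<le> \<Phi> y" "x \<in> X"
    using continuous_attains_inf[of "frontier X" \<Phi>] continuous_on_subset[OF \<Phi>_continuous] by blast
  then have "x \<noteq> xd"
    using xd_interior by (auto simp: frontier_def)
  then have "0 < \<mu> / 2 * (norm (x - xd))\<^sup>2"
    using \<mu>_pos by simp
  then have "\<Phi> xd < \<Phi> x"
    using quadratic_growth[OF x(3)] by linarith
  also have "\<Phi> x \<le> (INF x\<in>frontier X. \<Phi> x)"
    using x by (intro cINF_greatest) auto
  finally show ?thesis
    by (simp add: gap_def)
qed

lemma below_gap_interior: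
  assumes "x \<in> X" "\<Phi> x - \<Phi> xd < gap"
  shows "x \<in> interior X"
proof (rule ccontr)
  assume "x \<notin> interior X"
  then have "x \<in> frontier X"
    using assms closure_subset by (auto simp: frontier_def)
  moreover have "bdd_below (\<Phi> ` frontier X)"
    using \<Phi>_min frontier_subset_closed[OF compact_imp_closed[OF compact_X]]
    by (intro bdd_belowI2) auto
  ultimately have "(INF x\<in>frontier X. \<Phi> x) \<le> \<Phi> x"
    by (intro cINF_lower)
  then show False
    using assms(2) by (simp add: gap_def)
qed

text \<open>
  Below the gap the sublevel set of \<open>\<Phi>\<close> in \<open>X\<close> is automatically in the interior, so restricting to
  \<open>P\<close> loses nothing and the set is the continuous image of a compact one.
\<close>

lemma compact_incentive_sublevel:
  assumes "c < gap"
  shows "compact (Psub c)"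
proof -
  have "Psub c = (\<lambda>x. - G0 x) ` {x \<in> X. \<Phi> x - \<Phi> xd \<le> c}"
  proof
    show "Psub c \<subseteq> (\<lambda>x. - G0 x) ` {x \<in> X. \<Phi> x - \<Phi> xd \<le> c}"
    proof
      fix p assume p: "p \<in> Psub c"
      then have "p = - G0 (resp p)"
        using G0_response by (simp add: incentive_sublevel_eq)
      then show "p \<in> (\<lambda>x. - G0 x) ` {x \<in> X. \<Phi> x - \<Phi> xd \<le> c}"
        using p response_in by (intro image_eqI) (auto simp: incentive_sublevel_eq loss_def)
    qed
    show "(\<lambda>x. - G0 x) ` {x \<in> X. \<Phi> x - \<Phi> xd \<le> c} \<subseteq> Psub c"
      using assms below_gap_interior
      by (auto simp: incentive_sublevel_def incentives_def response_uminus_G0)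
  qed
  moreover have "compact {x \<in> X. \<Phi> x - \<Phi> xd \<le> c}"
  proof -
    have "closed {x \<in> X. \<Phi> x - \<Phi> xd \<le> c}"
      by (intro continuous_on_closed_Collect_le continuous_intros \<Phi>_continuous
          compact_imp_closed[OF compact_X])
    then have "compact (X \<inter> {x \<in> X. \<Phi> x - \<Phi> xd \<le> c})"
      using compact_X by (intro compact_Int_closed)
    then show ?thesis
      by (simp add: Int_def conj_ac)
  qed
  moreover have "continuous_on {x \<in> X. \<Phi> x - \<Phi> xd \<le> c} (\<lambda>x. - G0 x)"
    by (intro continuous_intros continuous_on_subset[OF G0_continuous]) auto
  ultimately show ?thesis
    by (simp add: compact_continuous_image)
qed

lemma loss_derivative:
  obtains V' where "\<And>p. p \<in> P \<Longrightarrow> (loss has_derivative V' p) (at p)"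
    and "\<And>p. p \<in> P \<Longrightarrow> V' p (field p) \<le> - \<kappa> * loss p"
proof -
  have "\<forall>p\<in>P. \<exists>V'. (loss has_derivative V') (at p) \<and> V' (field p) \<le> - \<kappa> * loss p"
    using loss_dissipation by metis
  then show thesis
    using that by (metis bchoice)
qed

lemma forward_invariant_incentive_sublevel:
  assumes "c < gap"
  shows "forward_invariant field (Psub c)"
proof -
  obtain V' where V': "\<And>p. p \<in> P \<Longrightarrow> (loss has_derivative V' p) (at p)"
    "\<And>p. p \<in> P \<Longrightarrow> V' p (field p) \<le> - \<kappa> * loss p"
    using loss_derivative by blast
  have "V' p (field p) \<le> 0" if "p \<in> P" for p
    using V'(2)[OF that] mult_nonneg_nonneg[OF less_imp_le[OF \<kappa>_pos] loss_nonneg[of p]] by simp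
  then show ?thesis
    using V'(1) open_incentives compact_imp_closed[OF compact_incentive_sublevel[OF assms]]
    unfolding incentive_sublevel_eq by (intro sublevel_forward_invariant)
qed

lemma loss_exponential_decay:
  assumes "c < gap" and p: "trajectory_on {0..} field p" "p 0 \<in> Psub c" and "0 \<le> t"
  shows "p t \<in> P" "loss (p t) \<le> loss (p 0) * exp (- \<kappa> * t)"
proof -
  obtain V' where V': "\<And>p. p \<in> P \<Longrightarrow> (loss has_derivative V' p) (at p)"
    "\<And>p. p \<in> P \<Longrightarrow> V' p (field p) \<le> - \<kappa> * loss p"
    using loss_derivative by blast
  have traj: "trajectory_on {0..t} field p"
    by (rule trajectory_on_subset[OF p(1)]) auto
  then have in_P: "p s \<in> P" if "s \<in> {0..t}" for s
    using forward_invariant_incentive_sublevel[OF \<open>c < gap\<close>] p(2) that \<open>0 \<le> t\<close>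
    unfolding forward_invariant_def incentive_sublevel_eq by blast
  then show "p t \<in> P"
    using \<open>0 \<le> t\<close> by simp
  show "loss (p t) \<le> loss (p 0) * exp (- \<kappa> * t)"
    by (rule lyapunov_decay[OF V' traj \<open>0 \<le> t\<close> in_P])
qed

text \<open>
  Exponential decay passes from the loss to the response by quadratic growth, and then to the
  incentive because \<open>G0\<close> is continuous and \<open>p t = - G0 (resp (p t))\<close> in \<open>P\<close>.
\<close>

lemma trajectory_tendsto:
  assumes "c < gap" and p: "trajectory_on {0..} field p" "p 0 \<in> Psub c"
  shows "(p \<longlongrightarrow> - G0 xd) at_top"
proof -
  note decay = loss_exponential_decay[OF assms]
  have "((\<lambda>t. exp (- \<kappa> * t)) \<longlongrightarrow> 0) at_top"
    using \<kappa>_pos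
    by (intro filterlim_compose[OF exp_at_bot] filterlim_tendsto_neg_mult_at_bot[OF tendsto_const]
        filterlim_ident) auto
  then have lim: "((\<lambda>t. 2 / \<mu> * (loss (p 0) * exp (- \<kappa> * t))) \<longlongrightarrow> 0) at_top"
    by (intro tendsto_mult_right_zero)
  have bound: "\<forall>\<^sub>F t in at_top. (norm (resp (p t) - xd))\<^sup>2 \<le> 2 / \<mu> * (loss (p 0) * exp (- \<kappa> * t))"
    using eventually_ge_at_top[of 0]
  proof eventually_elim
    case (elim t)
    have "\<mu> / 2 * (norm (resp (p t) - xd))\<^sup>2 \<le> loss (p 0) * exp (- \<kappa> * t)"
      using quadratic_growth[OF response_in, of "p t"] decay(2)[OF elim] by (simp add: loss_def)
    then show ?case
      using \<mu>_pos by (simp add: field_simps)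
  qed
  have "((\<lambda>t. (norm (resp (p t) - xd))\<^sup>2) \<longlongrightarrow> 0) at_top"
    by (rule tendsto_sandwich[OF _ bound tendsto_const lim]) simp
  then have "((\<lambda>t. sqrt ((norm (resp (p t) - xd))\<^sup>2)) \<longlongrightarrow> sqrt 0) at_top"
    by (rule tendsto_real_sqrt)
  then have "((\<lambda>t. norm (resp (p t) - xd)) \<longlongrightarrow> 0) at_top"
    by simp
  then have "((\<lambda>t. resp (p t)) \<longlongrightarrow> xd) at_top"
    by (rule LIM_zero_cancel[OF tendsto_norm_zero_cancel])
  then have "((\<lambda>t. - G0 (resp (p t))) \<longlongrightarrow> - G0 xd) at_top"
    by (intro tendsto_minus continuous_on_tendsto_compose[OF G0_continuous _ xd_in])
       (simp_all add: response_in)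
  moreover have "\<forall>\<^sub>F t in at_top. - G0 (resp (p t)) = p t"
    using eventually_ge_at_top[of 0] by eventually_elim (rule G0_response[OF decay(1)])
  ultimately show ?thesis
    by (rule Lim_transform_eventually)
qed

lemma uminus_G0_xd_in: "- G0 xd \<in> P"
  using xd_interior by (auto simp: incentives_def)

text \<open>A stationary response has zero loss by the Polyak-Lojasiewicz inequality.\<close>

lemma equilibria_incentive_sublevel:
  assumes "0 \<le> c"
  shows "{p \<in> Psub c. equilibrium field p} = {- G0 xd}"
proof -
  have "- G0 xd \<in> Psub c" "equilibrium field (- G0 xd)"
    using assms uminus_G0_xd_in grad_xd response_uminus_G0[OF xd_in]
    by (auto simp: incentive_sublevel_def equilibrium_def incentive_field_def)
  moreover have "p = - G0 xd" if "p \<in> Psub c" "equilibrium field p" for p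
  proof -
    have "2 * \<mu> * (\<Phi> (resp p) - \<Phi> xd) \<le> 0"
      using that(2) gradient_dominates_loss[OF response_in, of p]
      by (simp add: equilibrium_def incentive_field_def)
    then have "\<Phi> (resp p) - \<Phi> xd \<le> 0"
      using \<mu>_pos by (simp add: mult_le_0_iff)
    then have "\<mu> / 2 * (norm (resp p - xd))\<^sup>2 \<le> 0"
      using quadratic_growth[OF response_in, of p] by linarith
    then have "resp p = xd"
      using \<mu>_pos by (simp add: mult_le_0_iff)
    then show ?thesis
      using that(1) G0_response[of p] by (simp add: incentive_sublevel_eq)
  qed
  ultimately show ?thesis
    by blast
qed

lemma incentive_sublevel_neighbourhood:
  assumes "0 < c"
  obtains \<delta> where "0 < \<delta>" "\<And>p. dist p (- G0 xd) < \<delta> \<Longrightarrow> p \<in> Psub c"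
proof -
  have "open {p. loss p < c}"
    by (intro open_Collect_less loss_continuous continuous_on_const)
  then have "open (P \<inter> {p. loss p < c})"
    using open_incentives by (rule open_Int[rotated])
  moreover have "- G0 xd \<in> P \<inter> {p. loss p < c}"
    using assms uminus_G0_xd_in response_uminus_G0[OF xd_in] by (simp add: loss_def)
  ultimately obtain \<delta> where "0 < \<delta>" "\<forall>p. dist p (- G0 xd) < \<delta> \<longrightarrow> p \<in> P \<inter> {p. loss p < c}"
    unfolding open_dist by blast
  then show thesis
    by (intro that[of \<delta>]) (auto simp: incentive_sublevel_eq)
qed

lemma incentive_sublevel_small:
  assumes "0 < \<epsilon>"
  obtains c where "0 < c" "c < gap" "\<And>p. p \<in> Psub c \<Longrightarrow> dist p (- G0 xd) < \<epsilon>"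
proof -
  obtain \<eta> where \<eta>: "0 < \<eta>" "\<And>x. x \<in> X \<Longrightarrow> dist x xd < \<eta> \<Longrightarrow> dist (G0 x) (G0 xd) < \<epsilon>"
    using G0_continuous xd_in assms unfolding continuous_on_iff by metis
  \<comment> \<open>By quadratic growth, this level keeps the response within distance \<open>\<eta> / 2\<close> of \<open>xd\<close>.\<close>
  define c where "c = min (gap / 2) (\<mu> / 2 * (\<eta> / 2)\<^sup>2)"
  have "dist p (- G0 xd) < \<epsilon>" if p: "p \<in> Psub c" for p
  proof -
    have "\<mu> / 2 * (norm (resp p - xd))\<^sup>2 \<le> \<mu> / 2 * (\<eta> / 2)\<^sup>2"
      using p quadratic_growth[OF response_in, of p]
      by (simp add: incentive_sublevel_def c_def)
    then have "(norm (resp p - xd))\<^sup>2 \<le> (\<eta> / 2)\<^sup>2"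
      using \<mu>_pos by simp
    then have "norm (resp p - xd) \<le> \<eta> / 2"
      using \<eta>(1) by (simp add: power2_le_iff_abs_le)
    then have "dist (G0 (resp p)) (G0 xd) < \<epsilon>"
      using \<eta> response_in by (simp add: dist_norm)
    then have "dist (- G0 (resp p)) (- G0 xd) < \<epsilon>"
      by (simp add: dist_minus)
    then show ?thesis
      using p G0_response[of p] by (simp add: incentive_sublevel_eq)
  qed
  then show thesis
    using gap_pos \<mu>_pos \<eta>(1) by (intro that[of c]) (auto simp: c_def)
qed

lemma global_trajectory_tendsto:
  assumes "c < gap" "p0 \<in> Psub c"
  obtains p where "trajectory_on {0..} field p" "p 0 = p0" "(p \<longlongrightarrow> - G0 xd) at_top"
    and "\<And>q t. trajectory_on {0..} field q \<Longrightarrow> q 0 = p0 \<Longrightarrow> 0 \<le> t \<Longrightarrow> q t = p t"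
proof -
  obtain p where p: "trajectory_on {0..} field p" "p 0 = p0"
    using lipschitz_global_trajectory[OF field_lipschitz] by blast
  moreover have "(p \<longlongrightarrow> - G0 xd) at_top"
    using trajectory_tendsto[OF assms(1) p(1)] p(2) assms(2) by simp
  moreover have "q t = p t" if "trajectory_on {0..} field q" "q 0 = p0" "0 \<le> t" for q t
    using trajectory_unique[OF field_lipschitz that(1) p(1)] that p(2) by simp
  ultimately show thesis
    by (rule that)
qed

text \<open>
  Small sublevel sets are small neighbourhoods of the equilibrium, so their invariance is Lyapunov
  stability.
\<close>

lemma asymptotically_stable_uminus_G0_xd: "asymptotically_stable field (- G0 xd)"
  unfolding asymptotically_stable_def
proof (intro conjI)
  show "equilibrium field (- G0 xd)"
    using equilibria_incentive_sublevel[of 0] by blast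
  show "lyapunov_stable field (- G0 xd)"
    unfolding lyapunov_stable_def
  proof (intro allI impI)
    fix \<epsilon> :: real assume "0 < \<epsilon>"
    then obtain c where c: "0 < c" "c < gap" "\<And>p. p \<in> Psub c \<Longrightarrow> dist p (- G0 xd) < \<epsilon>"
      using incentive_sublevel_small by blast
    obtain \<delta> where "0 < \<delta>" "\<And>p. dist p (- G0 xd) < \<delta> \<Longrightarrow> p \<in> Psub c"
      using incentive_sublevel_neighbourhood[OF c(1)] by blast
    then show "\<exists>\<delta>>0. \<forall>T\<ge>0. \<forall>p. trajectory_on {0..T} field p \<and> dist (p 0) (- G0 xd) < \<delta> \<longrightarrow>
        (\<forall>t\<in>{0..T}. dist (p t) (- G0 xd) < \<epsilon>)"
      using forward_invariant_incentive_sublevel[OF c(2)] c(3)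
      unfolding forward_invariant_def by meson
  qed
  show "locally_attractive field (- G0 xd)"
  proof -
    obtain \<delta> where \<delta>: "0 < \<delta>" "\<And>p. dist p (- G0 xd) < \<delta> \<Longrightarrow> p \<in> Psub (gap / 2)"
      using incentive_sublevel_neighbourhood[of "gap / 2"] gap_pos by auto
    have "gap / 2 < gap"
      using gap_pos by simp
    then show ?thesis
      unfolding locally_attractive_def
      using \<delta> global_trajectory_tendsto trajectory_tendsto by metis
  qed
qed

end

section \<open>Derivatives on a box\<close>

lemma compact_strategy_space:
  assumes "\<And>i. compact (Xs i)" "\<And>i. convex (Xs i)"
  shows "compact (strategy_space Xs)"
proof -
  have "\<exists>a b. Xs i = {a..b}" for i
    using connected_compact_interval_1[of "Xs i"] assms convex_connected by blast
  then obtain a b where "\<And>i. Xs i = {a i..b i}"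
    by metis
  then have "strategy_space Xs = cbox (\<chi> i. a i) (\<chi> i. b i)"
    by (auto simp: strategy_space_def mem_box_cart)
  then show ?thesis
    by simp
qed

lemma convex_strategy_space:
  assumes "\<And>i. convex (Xs i)"
  shows "convex (strategy_space Xs)"
  using assms by (auto simp: strategy_space_def convex_def)

text \<open>
  One-sided partial derivatives are unique: every slice of the box is a nondegenerate interval, even
  through a point of a face.
\<close>

lemma slice_not_isolated:
  assumes "\<And>i. convex (Xs i)" and "z \<in> interior (strategy_space Xs)" and "x \<in> strategy_space Xs"
  shows "at 0 within {s. x + s *\<^sub>R axis i 1 \<in> strategy_space Xs} \<noteq> bot"
proof -
  define S where "S = {s. x + s *\<^sub>R axis i 1 \<in> strategy_space Xs}"
  have S_eq: "S = {s. x $ i + s \<in> Xs i}"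
    using assms(3) by (auto simp: S_def strategy_space_def axis_def)
  have "convex S"
    unfolding S_def
  proof (rule convexI)
    fix s t u v :: real
    assume s: "s \<in> {s. x + s *\<^sub>R axis i 1 \<in> strategy_space Xs}"
      and t: "t \<in> {s. x + s *\<^sub>R axis i 1 \<in> strategy_space Xs}"
      and uv: "0 \<le> u" "0 \<le> v" "u + v = 1"
    have "u *\<^sub>R (x + s *\<^sub>R axis i 1) + v *\<^sub>R (x + t *\<^sub>R axis i 1)
        = (u + v) *\<^sub>R x + (u * s + v * t) *\<^sub>R axis i 1"
      by (simp add: algebra_simps)
    then show "u *\<^sub>R s + v *\<^sub>R t \<in> {s. x + s *\<^sub>R axis i 1 \<in> strategy_space Xs}"
      using convexD[OF convex_strategy_space[OF assms(1)] s[simplified] t[simplified] uv] uv(3)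
      by simp
  qed
  moreover have "0 \<in> S"
    using assms(3) by (simp add: S_def)
  moreover have "S \<noteq> {r}" for r
  proof -
    obtain e where e: "0 < e" "cball z e \<subseteq> strategy_space Xs"
      using assms(2) mem_interior_cball by blast
    have "z + e *\<^sub>R axis i 1 \<in> cball z e" "z \<in> cball z e"
      using e(1) by (auto simp: dist_norm)
    then have "z + e *\<^sub>R axis i 1 \<in> strategy_space Xs" "z \<in> strategy_space Xs"
      using e(2) by blast+
    then have "(z + e *\<^sub>R axis i 1) $ i \<in> Xs i" "z $ i \<in> Xs i"
      unfolding strategy_space_def by blast+
    then have "z $ i - x $ i \<in> S" "z $ i + e - x $ i \<in> S"
      by (auto simp: S_eq axis_def)
    then show ?thesis
      using e(1) by auto
  qed
  ultimately have "0 islimpt S"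
    by (intro connected_imp_perfect convex_connected)
  then show ?thesis
    by (simp add: S_def trivial_limit_within)
qed

lemma partial_on_eq:
  assumes "at 0 within {s. x + s *\<^sub>R axis i 1 \<in> X} \<noteq> bot" and D: "(f has_derivative D) (at x within X)"
  shows "partial_on X f i x = D (axis i 1)"
proof -
  define S where "S = {s. x + s *\<^sub>R axis i 1 \<in> X}"
  have "((\<lambda>s. x + s *\<^sub>R axis i 1) has_vector_derivative axis i 1) (at 0 within S)"
    by (auto intro!: derivative_eq_intros)
  moreover have "(f has_derivative D) (at (x + 0 *\<^sub>R axis i 1) within (\<lambda>s. x + s *\<^sub>R axis i 1) ` S)"
    using D by (auto simp: S_def intro: has_derivative_subset)
  ultimately have "(f \<circ> (\<lambda>s. x + s *\<^sub>R axis i 1) has_vector_derivative D (axis i 1)) (at 0 within S)"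
    by (rule vector_derivative_diff_chain_within)
  then show ?thesis
    using vector_derivative_within[of 0 S] assms(1)
    by (simp add: partial_on_def S_def o_def)
qed

lemma gradient_on_has_derivative:
  fixes f :: "real^'n \<Rightarrow> real"
  assumes "\<And>i. at 0 within {s. x + s *\<^sub>R axis i 1 \<in> X} \<noteq> bot" and "f differentiable (at x within X)"
  shows "(f has_derivative (\<bullet>) (gradient_on X f x)) (at x within X)"
proof -
  obtain D where D: "(f has_derivative D) (at x within X)"
    using assms(2) by (auto simp: differentiable_def)
  have "D v = gradient_on X f x \<bullet> v" for v
  proof -
    have "D v = D (\<Sum>i\<in>UNIV. v $ i *\<^sub>R axis i 1)"
      using basis_expansion[of v] by (simp add: scalar_mult_eq_scaleR)
    also have "\<dots> = (\<Sum>i\<in>UNIV. v $ i * D (axis i 1))"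
      using has_derivative_linear[OF D] by (simp add: linear_sum linear_scale)
    also have "\<dots> = gradient_on X f x \<bullet> v"
      by (simp add: gradient_on_def inner_vec_def partial_on_eq[OF assms(1) D] mult.commute)
    finally show ?thesis .
  qed
  then have "D = (\<bullet>) (gradient_on X f x)"
    by (rule ext)
  then show ?thesis
    using D by simp
qed

text \<open>
  The \<open>i\<close>-th entry of the pseudo-gradient is the \<open>i\<close>-th component of the gradient of \<open>cost i\<close>, which
  is differentiable as \<open>cost i\<close> is twice differentiable.
\<close>

lemma pseudo_gradient_differentiable:
  fixes cost :: "'n::finite \<Rightarrow> real^'n \<Rightarrow> real"
  assumes nb: "\<And>x i. x \<in> X \<Longrightarrow> at 0 within {s. x + s *\<^sub>R axis i 1 \<in> X} \<noteq> bot"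
    and cost: "\<And>i. C2_on X (cost i)" and "x \<in> X"
  shows "pseudo_gradient X cost differentiable (at x within X)"
proof -
  have "\<exists>g H. \<forall>x\<in>X. (cost i has_derivative (\<bullet>) (g x)) (at x within X) \<and>
      (g has_derivative (*v) (H x)) (at x within X)" for i
    using cost[of i] unfolding C2_on_def by blast
  then obtain g H where
    g: "\<And>i x. x \<in> X \<Longrightarrow> (cost i has_derivative (\<bullet>) (g i x)) (at x within X)" and
    H: "\<And>i x. x \<in> X \<Longrightarrow> (g i has_derivative (*v) (H i x)) (at x within X)"
    by metis
  have eq: "pseudo_gradient X cost y = (\<chi> i. g i y $ i)" if "y \<in> X" for y
    using partial_on_eq[OF nb[OF that] g[OF that]]
    by (simp add: pseudo_gradient_def vec_eq_iff inner_axis)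
  have "((\<lambda>y. \<chi> i. g i y $ i) has_derivative (\<lambda>v. \<chi> i. (H i x *v v) $ i)) (at x within X)"
  proof (subst has_derivative_componentwise_within, intro ballI)
    fix b :: "real^'n" assume "b \<in> Basis"
    then obtain i where b: "b = axis i 1"
      by (auto simp: Basis_vec_def)
    show "((\<lambda>y. (\<chi> i. g i y $ i) \<bullet> b) has_derivative (\<lambda>v. (\<chi> i. (H i x *v v) $ i) \<bullet> b)) (at x within X)"
      using bounded_linear.has_derivative[OF bounded_linear_vec_nth H[OF \<open>x \<in> X\<close>, of i], of i]
      by (simp add: b inner_axis)
  qed
  from has_derivative_transform[OF \<open>x \<in> X\<close> _ this]
  have "(pseudo_gradient X cost has_derivative (\<lambda>v. \<chi> i. (H i x *v v) $ i)) (at x within X)"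
    using eq by blast
  then show ?thesis
    by (rule differentiableI)
qed

text \<open>The antisymmetric part of \<open>A\<close> does not contribute to the quadratic form.\<close>

lemma coercive_if_Sym_loewner:
  assumes "loewner_le (a *\<^sub>R mat 1) (Sym A)"
  shows "a * (norm v)\<^sup>2 \<le> v \<bullet> (A *v v)"
proof -
  have "0 \<le> v \<bullet> ((Sym A - a *\<^sub>R mat 1) *v v)"
    using assms by (simp add: loewner_le_def)
  also have "(Sym A - a *\<^sub>R mat 1) *v v = (1 / 2) *\<^sub>R (A *v v + v v* A) - a *\<^sub>R v"
    by (simp add: Sym_def matrix_vector_mult_diff_rdistrib matrix_vector_mult_add_rdistrib
        transpose_matrix_vector flip: scaleR_matrix_vector_assoc)
  also have "v \<bullet> \<dots> = v \<bullet> (A *v v) - a * (norm v)\<^sup>2"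
    using dot_lmul_matrix[of v A v]
    by (simp add: inner_diff_right inner_add_right inner_commute[of v "v v* A"] power2_norm_eq_inner)
  finally show ?thesis
    by simp
qed

lemma matrix_lipschitz_on_bounded:
  fixes A :: "real^'n \<Rightarrow> real^'n^'n"
  assumes "matrix_lipschitz_on L X A" "bounded X" "z \<in> X"
  obtains M where "0 < M" "\<And>x v. x \<in> X \<Longrightarrow> norm (A x *v v) \<le> M * norm v"
proof -
  obtain r where r: "\<And>x. x \<in> X \<Longrightarrow> dist x z \<le> r"
    using \<open>bounded X\<close> bounded_any_center[of X z] by (auto simp: dist_commute)
  have "0 \<le> r"
    using r[OF \<open>z \<in> X\<close>] by simp
  \<comment> \<open>\<open>L\<close> may be negative if \<open>X\<close> is a single point; the summand \<open>1\<close> makes \<open>M\<close> positive.\<close>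
  define M where "M = \<bar>L\<bar> * r + onorm ((*v) (A z)) + 1"
  have "norm (A x *v v) \<le> M * norm v" if "x \<in> X" for x v
  proof -
    have "norm ((A x - A z) *v v) \<le> onorm ((*v) (A x - A z)) * norm v"
      by (intro onorm matrix_vector_mul_bounded_linear)
    also have "\<dots> \<le> (\<bar>L\<bar> * r) * norm v"
    proof (rule mult_right_mono)
      have "onorm ((*v) (A x - A z)) \<le> L * dist x z"
        using assms(1,3) that by (simp add: matrix_lipschitz_on_def)
      also have "\<dots> \<le> \<bar>L\<bar> * r"
        using r[OF that] by (intro mult_mono) auto
      finally show "onorm ((*v) (A x - A z)) \<le> \<bar>L\<bar> * r" .
    qed simp
    finally have "norm ((A x - A z) *v v) \<le> (\<bar>L\<bar> * r) * norm v" .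
    moreover have "norm (A z *v v) \<le> onorm ((*v) (A z)) * norm v"
      by (intro onorm matrix_vector_mul_bounded_linear)
    moreover have "norm (A x *v v) \<le> norm ((A x - A z) *v v) + norm (A z *v v)"
      using norm_triangle_ineq[of "(A x - A z) *v v" "A z *v v"]
      by (simp add: matrix_vector_mult_diff_rdistrib)
    ultimately show ?thesis
      using norm_ge_zero[of v] unfolding M_def distrib_right by linarith
  qed
  moreover have "0 < M"
    unfolding M_def using \<open>0 \<le> r\<close> onorm_pos_le[of "(*v) (A z)"]
    by (simp add: add_nonneg_pos)
  ultimately show thesis
    using that by blast
qed

theorem theorem1:
  fixes Xs :: "'n::finite \<Rightarrow> real set"
    and X :: "(real^'n) set"
    and cost :: "'n \<Rightarrow> real^'n \<Rightarrow> real"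
    and G0 :: "real^'n \<Rightarrow> real^'n"
    and \<Phi> :: "real^'n \<Rightarrow> real"
    and xd pd :: "real^'n"
    and L1 L2 m \<mu> cstar :: real
    and P :: "(real^'n) set"
    and Pc :: "real \<Rightarrow> (real^'n) set"
    and f :: "real^'n \<Rightarrow> real^'n"
  assumes Xs: "\<And>i. compact (Xs i)" "\<And>i. convex (Xs i)"
    and X_eq: "X = strategy_space Xs"
    and cost_C2: "\<And>i. C2_on X (cost i)"
    and G0_eq: "G0 = pseudo_gradient X cost"
    and A1_lipschitz: "matrix_lipschitz_on L1 X (\<lambda>x. jacobian G0 (at x within X))"
    and A1_m: "m > 0"
    and A1_monotone: "\<And>x. x \<in> X \<Longrightarrow>
          loewner_le ((m / 2) *\<^sub>R mat 1) (Sym (jacobian G0 (at x within X)))"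
    and A2_diff: "\<Phi> differentiable_on X"
    and A2_mu: "\<mu> > 0"
    and A2_convex: "strongly_convex_on \<mu> X \<Phi>"
    and A2_lipschitz: "L2-lipschitz_on X (gradient_on X \<Phi>)"
    and A2_min: "is_arg_min \<Phi> (\<lambda>x. x \<in> X) xd"
    and A2_interior: "xd \<in> interior X"
    and cstar_eq: "cstar = (INF x\<in>frontier X. \<Phi> x) - \<Phi> xd"
    and pd_eq: "pd = - G0 xd"
    and P_eq: "P = incentives X G0"
    and Pc_eq: "Pc = incentive_sublevel X G0 \<Phi> xd"
    and f_eq: "f = incentive_field X G0 \<Phi>"
  shows "cstar > 0 \<and> pd \<in> P \<and>
    (\<forall>c. 0 \<le> c \<and> c < cstar \<longrightarrow>
       compact (Pc c) \<and> forward_invariant f (Pc c) \<and>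
       {p \<in> Pc c. equilibrium f p} = {pd} \<and> asymptotically_stable f pd \<and>
       (\<forall>p0 \<in> Pc c. \<exists>p. trajectory_on {0..} f p \<and> p 0 = p0 \<and>
          (\<forall>q. trajectory_on {0..} f q \<and> q 0 = p0 \<longrightarrow> (\<forall>t\<ge>0. q t = p t)) \<and>
          (p \<longlongrightarrow> pd) at_top))"
proof -
  define J where "J x = jacobian G0 (at x within X)" for x
  have xd: "xd \<in> X"
    using A2_min by (simp add: is_arg_min_def)
  have nb: "at 0 within {s. x + s *\<^sub>R axis i 1 \<in> X} \<noteq> bot" if "x \<in> X" for x i
    using slice_not_isolated[of Xs xd x i] Xs(2) A2_interior that by (simp add: X_eq)
  have "compact X"
    unfolding X_eq using Xs by (rule compact_strategy_space)
  obtain M where M: "0 < M" "\<And>x v. x \<in> X \<Longrightarrow> norm (J x *v v) \<le> M * norm v"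
    using matrix_lipschitz_on_bounded[OF A1_lipschitz compact_imp_bounded[OF \<open>compact X\<close>] xd]
    unfolding J_def by blast
  interpret incentive_design X G0 J \<Phi> xd "m / 2" M \<mu> L2
  proof
    show "convex X"
      unfolding X_eq using Xs(2) by (rule convex_strategy_space)
    show "(G0 has_derivative (*v) (J x)) (at x within X)" if "x \<in> X" for x
      using pseudo_gradient_differentiable[OF nb cost_C2 that]
      unfolding J_def G0_eq jacobian_works by simp
    show "m / 2 * (norm v)\<^sup>2 \<le> v \<bullet> (J x *v v)" if "x \<in> X" for x v
      unfolding J_def by (rule coercive_if_Sym_loewner[OF A1_monotone[OF that]])
    show "(\<Phi> has_derivative (\<bullet>) (gradient_on X \<Phi> x)) (at x within X)" if "x \<in> X" for x
      using gradient_on_has_derivative[OF nb[OF that]] A2_diff that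
      by (simp add: differentiable_on_def)
    show "\<Phi> xd \<le> \<Phi> x" if "x \<in> X" for x
      using A2_min that by (auto simp: is_arg_min_def not_less)
  qed (use \<open>compact X\<close> A1_m M A2_mu A2_convex A2_lipschitz A2_interior in auto)
  have cstar: "cstar = gap"
    by (simp add: cstar_eq gap_def)
  show ?thesis
    unfolding cstar pd_eq P_eq Pc_eq f_eq
  proof (intro conjI allI impI ballI; (elim conjE)?)
    fix c p0 assume "c < gap" "p0 \<in> incentive_sublevel X G0 \<Phi> xd c"
    then show "\<exists>p. trajectory_on {0..} field p \<and> p 0 = p0 \<and>
        (\<forall>q. trajectory_on {0..} field q \<and> q 0 = p0 \<longrightarrow> (\<forall>t\<ge>0. q t = p t)) \<and>
        (p \<longlongrightarrow> - G0 xd) at_top"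
      by (rule global_trajectory_tendsto) blast
  qed (rule gap_pos uminus_G0_xd_in asymptotically_stable_uminus_G0_xd compact_incentive_sublevel
      forward_invariant_incentive_sublevel equilibria_incentive_sublevel; assumption?)+
qed

end
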